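(* The function $\beta$ is a strictly decreasing function of $c$ for $c\ge-\ln 3$.
   Context: For $c\in\mathbb{R}$, $$\beta(c)=\frac{\int_{\mathbb{R}^3}\frac{1}{e^{|p|^2+c}+1}dp}{\left(\int_{\mathbb{R}^3}\frac{|p|^2}{e^{|p|^2+c}+1}dp\right)^{3/5}} .$$ *)

theory Defs
  imports "HOL-Analysis.Analysis"
begin

text \<open>
  Both integrands are integrable for every real \<open>c\<close>, and both integrals are positive,
  so neither the value 0 of a non-integrable Bochner integral nor a base 0 of
  \<open>powr\<close> is ever involved.
\<close>

definition \<beta> :: "real \<Rightarrow> real" where
  "\<beta> c =
     (LINT p|lborel. 1 / (exp ((norm (p :: real ^ 3))\<^sup>2 + c) + 1)) /
     (LINT p|lborel. (norm (p :: real ^ 3))\<^sup>2 / (exp ((norm p)\<^sup>2 + c) + 1)) powr (3 / 5)"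

end

theory Submission
  imports Defs "HOL-Probability.Distributions"
begin

text \<open>
  The reason for the monotonicity is an invariance. Write \<open>f\<^sub>c p = 1 / (exp (|p|\<^sup>2 + c) + 1)\<close>, and let
  \<open>N c\<close> and \<open>E c\<close> be the integrals of \<open>f\<^sub>c\<close> and of \<open>|p|\<^sup>2 f\<^sub>c\<close>. Replacing a profile \<open>f p\<close> by its dilation
  \<open>f (s p)\<close> multiplies the two integrals by \<open>s\<close> to the powers \<open>-3\<close> and \<open>-5\<close>, so it does not change the
  quotient \<open>\<integral> f / (\<integral> |p|\<^sup>2 f) powr (3 / 5)\<close>.

  Let \<open>c < d\<close>. Then \<open>E d < E c\<close>, and there is a factor \<open>s < 1\<close> for which the dilated profile
  \<open>h p = f\<^sub>d (s p)\<close> has the same second moment as \<open>f\<^sub>c\<close>. The exponents \<open>s\<^sup>2 |p|\<^sup>2 + d\<close> and \<open>|p|\<^sup>2 + c\<close>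
  agree on exactly one sphere \<open>|p| = r\<close>, and there \<open>h - f\<^sub>c\<close> changes sign from negative (inside) to
  positive (outside). Hence \<open>(|p|\<^sup>2 - r\<^sup>2) (h - f\<^sub>c)\<close> is positive off the sphere and its integral is
  positive. As the second moments agree, this integral is \<open>r\<^sup>2 (\<integral> f\<^sub>c - \<integral> h)\<close>. So \<open>h\<close>
  has less mass than \<open>f\<^sub>c\<close> at the same second moment, which is the claim.

  The argument works in every dimension \<open>n\<close>, with exponent \<open>n / (n + 2)\<close>. The crossing is \<open>dilated_fermi_mass_less\<close>, and the normalisation by dilation is in
  \<open>fermi_moment_ratio_less\<close>.
\<close>

section \<open>Lebesgue integrals on Euclidean space\<close>

text \<open>If the integral vanished, the integrand would vanish almost everywhere, but a nonempty open set is not null.\<close>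

lemma integral_pos_of_pos_on_open:
  fixes f :: "'a::euclidean_space \<Rightarrow> real"
  assumes int: "integrable lborel f" and nonneg: "\<And>x. 0 \<le> f x"
    and U: "open U" "U \<noteq> {}" and pos: "\<And>x. x \<in> U \<Longrightarrow> 0 < f x"
  shows "0 < (LINT x|lborel. f x)"
proof (rule ccontr)
  assume "\<not> ?thesis"
  moreover have "0 \<le> (LINT x|lborel. f x)"
    using nonneg by simp
  ultimately have "(LINT x|lborel. f x) = 0"
    by linarith
  then have "AE x in lborel. f x = 0"
    using integral_nonneg_eq_0_iff_AE[OF int] nonneg by simp
  then have "AE x in lborel. x \<notin> U"
    by eventually_elim (use pos in force)
  then have "U \<in> null_sets lborel"
    using U(1) by (subst AE_iff_null_sets) auto
  then have "negligible U"
    by (simp add: negligible_iff_null_sets null_sets_completionI)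
  then show False
    using open_not_negligible U by blast
qed

lemma
  fixes f :: "'a::euclidean_space \<Rightarrow> real"
  assumes f: "integrable lborel f" and s: "0 < s"
  shows integrable_lborel_dilation: "integrable lborel (\<lambda>x. f (s *\<^sub>R x))"
    and integral_lborel_dilation:
      "(LINT x|lborel. f x) = s ^ DIM('a) * (LINT x|lborel. f (s *\<^sub>R x))"
proof -
  have [measurable]: "f \<in> borel_measurable borel"
    using f by auto
  let ?M = "density (distr lborel borel (\<lambda>x::'a. s *\<^sub>R x)) (\<lambda>_. ennreal (s ^ DIM('a)))"
  have M: "lborel = ?M"
    using lborel_affine[of s "0::'a"] s by simp
  have "integrable ?M f"
    using f M by simp
  then show "integrable lborel (\<lambda>x. f (s *\<^sub>R x))"
    using s by (simp add: integrable_density integrable_distr_eq)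
  have "(LINT x|lborel. f x) = (LINT x|?M. f x)"
    using M by simp
  also have "\<dots> = s ^ DIM('a) * (LINT x|lborel. f (s *\<^sub>R x))"
    using s by (simp add: integral_density integral_distr)
  finally show "(LINT x|lborel. f x) = s ^ DIM('a) * (LINT x|lborel. f (s *\<^sub>R x))" .
qed

text \<open>The Gaussian is a product of one-dimensional Gaussians, which are normal densities up to a factor.\<close>

lemma integrable_gaussian:
  assumes a: "0 < a"
  shows "integrable lborel (\<lambda>x::'a::euclidean_space. exp (- a * (norm x)\<^sup>2))"
proof -
  have "integrable lborel (\<lambda>t. sqrt (pi / a) * normal_density 0 (1 / sqrt (2 * a)) t)"
    using a by (intro integrable_mult_right integrable_normal_density) simp
  also have "(\<lambda>t. sqrt (pi / a) * normal_density 0 (1 / sqrt (2 * a)) t) = (\<lambda>t. exp (- a * t\<^sup>2))"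
    using a by (simp add: normal_density_def fun_eq_iff power_divide real_sqrt_divide real_sqrt_mult
        field_simps)
  finally have "integrable lborel (\<lambda>t. exp (- a * t\<^sup>2))" .
  then have finite_1: "(\<integral>\<^sup>+t. ennreal (exp (- a * t\<^sup>2)) \<partial>lborel) < \<infinity>"
    by (simp add: integrable_iff_bounded)
  have prod_form: "exp (- a * (norm x)\<^sup>2) = (\<Prod>b\<in>Basis. exp (- a * (x \<bullet> b)\<^sup>2))" for x :: 'a
  proof -
    have "(norm x)\<^sup>2 = (\<Sum>b\<in>Basis. (x \<bullet> b)\<^sup>2)"
      unfolding power2_norm_eq_inner by (subst euclidean_inner) (simp add: power2_eq_square)
    then show ?thesis
      by (simp add: sum_distrib_left exp_sum flip: sum_negf)
  qed
  have "(\<integral>\<^sup>+x. ennreal (exp (- a * (norm (x::'a))\<^sup>2)) \<partial>lborel)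
      = (\<integral>\<^sup>+x. (\<Prod>b\<in>Basis. ennreal (exp (- a * ((x::'a) \<bullet> b)\<^sup>2))) \<partial>lborel)"
    by (simp only: prod_form prod_ennreal exp_ge_zero)
  also have "\<dots> = (\<Prod>b\<in>(Basis::'a set). (\<integral>\<^sup>+t. ennreal (exp (- a * t\<^sup>2)) \<partial>lborel))"
    by (rule nn_integral_lborel_prod[where f="\<lambda>_ t. ennreal (exp (- a * t\<^sup>2))"]) auto
  also have "\<dots> < \<infinity>"
    using finite_1 by (simp add: power_less_top_ennreal)
  finally show ?thesis
    by (simp add: integrable_iff_bounded)
qed

section \<open>The Fermi-Dirac profile\<close>

definition fermi :: "real \<Rightarrow> 'a::euclidean_space \<Rightarrow> real" where
  "fermi c p = 1 / (exp ((norm p)\<^sup>2 + c) + 1)"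

lemma fermi_pos: "0 < fermi c p"
  by (simp add: fermi_def add_pos_pos)

lemma borel_measurable_fermi [measurable]: "fermi c \<in> borel_measurable borel"
  unfolding fermi_def by measurable

lemma fermi_less_iff: "fermi c p < fermi d q \<longleftrightarrow> (norm q)\<^sup>2 + d < (norm p)\<^sup>2 + c"
proof -
  have "fermi c p < fermi d q \<longleftrightarrow> exp ((norm q)\<^sup>2 + d) + 1 < exp ((norm p)\<^sup>2 + c) + 1"
    unfolding fermi_def divide_inverse mult_1 by (intro inverse_less_iff_less) (auto simp: add_pos_pos)
  then show ?thesis by simp
qed

lemma fermi_le_gaussian: "fermi c p \<le> exp (- c) * exp (- (norm p)\<^sup>2)"
proof -
  have "fermi c p \<le> 1 / exp ((norm p)\<^sup>2 + c)"
    unfolding fermi_def by (intro divide_left_mono) (auto simp: add_pos_pos)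
  then show ?thesis
    by (simp add: exp_add exp_minus field_simps)
qed

lemma integrable_fermi: "integrable lborel (fermi c :: 'a::euclidean_space \<Rightarrow> real)"
proof (rule Bochner_Integration.integrable_bound)
  show "integrable lborel (\<lambda>p::'a. exp (- c) * exp (- 1 * (norm p)\<^sup>2))"
    by (intro integrable_mult_right integrable_gaussian) simp
  show "AE p in lborel. norm (fermi c p :: real) \<le> norm (exp (- c) * exp (- 1 * (norm (p :: 'a))\<^sup>2))"
    using fermi_le_gaussian by (intro AE_I2) (simp add: abs_of_pos fermi_pos)
qed simp

lemma integrable_fermi_moment:
  "integrable lborel (\<lambda>p::'a::euclidean_space. (norm p)\<^sup>2 * fermi c p)"
proof (rule Bochner_Integration.integrable_bound)
  show "integrable lborel (\<lambda>p::'a. 2 * exp (- c) * exp (- (1 / 2) * (norm p)\<^sup>2))"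
    by (intro integrable_mult_right integrable_gaussian) simp
  have "(norm p)\<^sup>2 * fermi c p \<le> 2 * exp (- c) * exp (- (1 / 2) * (norm p)\<^sup>2)" for p :: 'a
  proof -
    let ?t = "(norm p)\<^sup>2"
    \<comment> \<open>Half of the Gaussian decay absorbs the factor \<open>|p|\<^sup>2\<close>.\<close>
    have "?t \<le> 2 * exp (?t / 2)"
      using exp_ge_add_one_self[of "?t / 2"] by linarith
    then have "?t * fermi c p \<le> (2 * exp (?t / 2)) * (exp (- c) * exp (- ?t))"
      using fermi_le_gaussian[of c p] fermi_pos[of c p] by (intro mult_mono) auto
    also have "\<dots> = 2 * exp (- c) * (exp (?t / 2) * exp (- ?t))"
      by simp
    also have "exp (?t / 2) * exp (- ?t) = exp (- (1 / 2) * ?t)"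
      by (simp flip: exp_add)
    finally show ?thesis .
  qed
  then show "AE p in lborel. norm ((norm p)\<^sup>2 * fermi c p)
      \<le> norm (2 * exp (- c) * exp (- (1 / 2) * (norm (p :: 'a))\<^sup>2))"
    by (intro AE_I2) (simp add: abs_mult abs_of_pos fermi_pos)
qed simp

lemma open_punctured_space:
  shows "open (- {0 :: 'a::euclidean_space})" "- {0 :: 'a} \<noteq> {}"
  using nonzero_Basis[OF SOME_Basis] by auto

lemma fermi_mass_pos: "0 < (LINT p|lborel. fermi c (p::'a::euclidean_space))"
  using integral_pos_of_pos_on_open[OF integrable_fermi _ open_UNIV] fermi_pos less_imp_le by blast

lemma fermi_moment_pos: "0 < (LINT p|lborel. (norm p)\<^sup>2 * fermi c (p::'a::euclidean_space))"
  by (rule integral_pos_of_pos_on_open[OF integrable_fermi_moment _ open_punctured_space])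
    (auto simp: fermi_pos less_imp_le)

lemma fermi_moment_less:
  assumes "c < d"
  shows "(LINT p|lborel. (norm p)\<^sup>2 * fermi d (p::'a::euclidean_space))
      < (LINT p|lborel. (norm p)\<^sup>2 * fermi c (p::'a))"
proof -
  have less: "fermi d p < fermi c p" for p :: 'a
    using assms by (simp add: fermi_less_iff)
  have "0 < (LINT p|lborel. (norm p)\<^sup>2 * fermi c (p::'a) - (norm p)\<^sup>2 * fermi d p)"
  proof (rule integral_pos_of_pos_on_open[OF _ _ open_punctured_space])
    show "0 \<le> (norm p)\<^sup>2 * fermi c p - (norm p)\<^sup>2 * fermi d p" for p :: 'a
      using less[of p] by (simp add: mult_left_mono)
    show "0 < (norm p)\<^sup>2 * fermi c p - (norm p)\<^sup>2 * fermi d p" if "p \<in> - {0}" for p :: 'a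
      using less[of p] that by simp
  qed (intro Bochner_Integration.integrable_diff integrable_fermi_moment)
  then show ?thesis
    by (simp add: integrable_fermi_moment)
qed

section \<open>Comparison at equal second moment\<close>

text \<open>
  Both profiles are decreasing functions of an exponent that is affine in \<open>|p|\<^sup>2\<close>, so their difference
  changes sign exactly where the exponents agree. Testing the difference against \<open>r\<^sup>2 - |p|\<^sup>2\<close>, with \<open>r\<close> the
  radius of that sphere, gives an integrand without negative values, and the second moments
  cancel from its integral.
\<close>

lemma dilated_fermi_mass_less:
  assumes "c < d" and s: "0 < s" "s < 1"
    and moments: "(LINT p|lborel. (norm p)\<^sup>2 * fermi d (s *\<^sub>R p :: 'a::euclidean_space))
      = (LINT p|lborel. (norm p)\<^sup>2 * fermi c (p::'a))"
  shows "(LINT p|lborel. fermi d (s *\<^sub>R p :: 'a)) < (LINT p|lborel. fermi c (p::'a))"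
proof -
  have gap: "0 < 1 - s\<^sup>2"
    using s by (simp add: power_less_one_iff abs_square_less_1)
  \<comment> \<open>The squared radius of the sphere on which \<open>s\<^sup>2 |p|\<^sup>2 + d = |p|\<^sup>2 + c\<close>.\<close>
  define R where "R = (d - c) / (1 - s\<^sup>2)"
  have R: "0 < R"
    using gap \<open>c < d\<close> by (simp add: R_def)
  let ?h = "\<lambda>p::'a. fermi d (s *\<^sub>R p)" and ?f = "\<lambda>p::'a. fermi c p"
  have int_h: "integrable lborel ?h"
    by (rule integrable_lborel_dilation[OF integrable_fermi s(1)])
  have int_f: "integrable lborel ?f"
    by (rule integrable_fermi)
  have "integrable lborel (\<lambda>p::'a. (1 / s\<^sup>2) * ((norm (s *\<^sub>R p))\<^sup>2 * ?h p))"
    by (intro integrable_mult_right integrable_lborel_dilation[OF integrable_fermi_moment s(1)])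
  then have int_h2: "integrable lborel (\<lambda>p::'a. (norm p)\<^sup>2 * ?h p)"
    using s by (simp add: power_mult_distrib)
  have int_f2: "integrable lborel (\<lambda>p::'a. (norm p)\<^sup>2 * ?f p)"
    by (rule integrable_fermi_moment)
  have inside: "?h p < ?f p \<longleftrightarrow> (norm p)\<^sup>2 < R"
    and outside: "?f p < ?h p \<longleftrightarrow> R < (norm p)\<^sup>2" for p
    unfolding R_def fermi_less_iff pos_less_divide_eq[OF gap] pos_divide_less_eq[OF gap]
    by (auto simp: power_mult_distrib algebra_simps)
  let ?test = "\<lambda>p::'a. (R - (norm p)\<^sup>2) * (?f p - ?h p)"
  have test_expand: "?test = (\<lambda>p. (R * ?f p - R * ?h p) - ((norm p)\<^sup>2 * ?f p - (norm p)\<^sup>2 * ?h p))"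
    by (auto simp: algebra_simps)
  have "0 < (LINT p|lborel. ?test p)"
  proof (rule integral_pos_of_pos_on_open)
    show "integrable lborel ?test"
      unfolding test_expand
      by (intro Bochner_Integration.integrable_diff integrable_mult_right int_f int_h int_f2 int_h2)
    show "0 \<le> ?test p" for p
      using inside[of p] outside[of p] by (auto simp: zero_le_mult_iff not_less)
    show "0 < ?test p" if "p \<in> ball 0 (sqrt R)" for p
    proof -
      have "(norm p)\<^sup>2 < R"
        using power_strict_mono[of "norm p" "sqrt R" 2] that R by simp
      then show ?thesis
        using inside[of p] by simp
    qed
    show "ball (0::'a) (sqrt R) \<noteq> {}"
      using R by simp
  qed simp
  also have "(LINT p|lborel. ?test p) = R * ((LINT p|lborel. ?f p) - (LINT p|lborel. ?h p))"
    unfolding test_expand using int_f int_h int_f2 int_h2 moments by (simp add: right_diff_distrib)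
  finally show ?thesis
    using R by (simp add: zero_less_mult_iff)
qed

text \<open>
  Dilation invariance of the quotient reduces the claim to profiles with equal second moment. The
  exponent \<open>n / (n + 2)\<close> is the one for which the powers of \<open>s\<close> from numerator and denominator cancel.
\<close>

lemma fermi_moment_ratio_less:
  assumes "c < d"
  defines "n \<equiv> real DIM('a::euclidean_space)"
  shows "(LINT p|lborel. fermi d (p::'a)) / (LINT p|lborel. (norm p)\<^sup>2 * fermi d (p::'a)) powr (n / (n + 2))
    < (LINT p|lborel. fermi c (p::'a)) / (LINT p|lborel. (norm p)\<^sup>2 * fermi c (p::'a)) powr (n / (n + 2))"
proof -
  define N where "N = (\<lambda>c. LINT p|lborel. fermi c (p::'a))"
  define E where "E = (\<lambda>c. LINT p|lborel. (norm p)\<^sup>2 * fermi c (p::'a))"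
  have E: "0 < E c" "0 < E d" "E d < E c"
    using fermi_moment_pos fermi_moment_less[OF \<open>c < d\<close>] by (auto simp: E_def)
  have n: "0 < n"
    by (simp add: n_def)
  \<comment> \<open>Dilation by \<open>s\<close> divides the second moment by \<open>s\<close> to the power \<open>n + 2\<close>.\<close>
  define s where "s = (E d / E c) powr (1 / (n + 2))"
  have s0: "0 < s"
    using E by (simp add: s_def)
  have s1: "s < 1"
    using E n powr_less_mono2[of "1 / (n + 2)" "E d / E c" 1] by (simp add: s_def)
  have s_mass: "s ^ DIM('a) = (E d / E c) powr (n / (n + 2))"
    using s0 by (simp add: n_def s_def powr_powr flip: powr_realpow)
  have s_moment: "s ^ (DIM('a) + 2) = E d / E c"
  proof -
    have "s ^ (DIM('a) + 2) = s powr (n + 2)"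
      using s0 powr_realpow[of s "DIM('a) + 2"] by (simp add: n_def add.commute)
    also have "\<dots> = E d / E c"
      using E n by (simp add: s_def powr_powr)
    finally show ?thesis .
  qed
  have "E d = s ^ DIM('a) * (LINT p|lborel. (norm (s *\<^sub>R p))\<^sup>2 * fermi d (s *\<^sub>R p :: 'a))"
    unfolding E_def by (rule integral_lborel_dilation[OF integrable_fermi_moment s0])
  also have "\<dots> = s ^ (DIM('a) + 2) * (LINT p|lborel. (norm p)\<^sup>2 * fermi d (s *\<^sub>R p :: 'a))"
    by (simp add: power_mult_distrib mult.assoc power_add power2_eq_square[of s])
  finally have "(LINT p|lborel. (norm p)\<^sup>2 * fermi d (s *\<^sub>R p :: 'a)) = E c"
    using E unfolding s_moment by (simp add: field_simps)
  then have "(LINT p|lborel. fermi d (s *\<^sub>R p :: 'a)) < N c"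
    unfolding E_def N_def by (rule dilated_fermi_mass_less[OF \<open>c < d\<close> s0 s1])
  moreover have "N d = s ^ DIM('a) * (LINT p|lborel. fermi d (s *\<^sub>R p :: 'a))"
    unfolding N_def by (rule integral_lborel_dilation[OF integrable_fermi s0])
  ultimately have "N d < (E d / E c) powr (n / (n + 2)) * N c"
    using s0 by (simp add: flip: s_mass)
  then have "N d / E d powr (n / (n + 2)) < N c / E c powr (n / (n + 2))"
    using E by (simp add: powr_divide field_simps)
  then show ?thesis
    by (simp add: N_def E_def)
qed

theorem proposition2p1: "strict_antimono_on {- ln 3..} \<beta>"
proof (rule monotone_onI)
  fix c d :: real
  assume "c < d"
  then show "\<beta> d < \<beta> c"
    using fermi_moment_ratio_less[where 'a="real ^ 3", of c d] by (simp add: \<beta>_def fermi_def)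
qed

end
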